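(* Let $P$ be a cubic polynomial with complex coefficients which has three distinct fixed points in $\mathbb{C}$. Then the multipliers of all three fixed points have real part $1$ if and only if the three fixed points are collinear (lie on a common real line in the plane $\mathbb{C}$) and at least one of the three multipliers has real part $1$.
   Context: A fixed point of a polynomial $P$ means a finite fixed point, i.e. $z_0\in\mathbb{C}$ with $P(z_0)=z_0$; its multiplier is $P'(z_0)$. *)

theory Defs
  imports "HOL-Analysis.Analysis" "HOL-Computational_Algebra.Polynomial"
begin

definition fixed_points :: "complex poly \<Rightarrow> complex set"
  where "fixed_points P = {z. poly P z = z}"

definition multiplier :: "complex poly \<Rightarrow> complex \<Rightarrow> complex"
  where "multiplier P z = poly (pderiv P) z"

end

theory Submission
  imports Defs
begin

text \<open>
  Write \<open>P(z) - z = k (z - a) (z - b) (z - c)\<close>. Then the multipliers minus one are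
  \<open>k (a - b) (a - c)\<close>, \<open>k (b - a) (b - c)\<close> and \<open>k (c - a) (c - b)\<close>, and the quotient of the first two
  is \<open>-(a - c) / (b - c)\<close>. If both are purely imaginary, this quotient is real, so the points are
  collinear. Conversely, if \<open>a - c = r (b - c)\<close> with \<open>r\<close> real, the three numbers are nonzero
  real multiples of \<open>k (b - c)\<^sup>2\<close>, so that one is purely imaginary iff all are.
\<close>

text \<open>Linear factors split off one at a time: since the points are distinct, each remaining
  root is a root of the cofactor. Comparing degrees makes the last cofactor constant.\<close>

lemma cubic_factor_roots:
  fixes Q :: "'a::field poly"
  assumes deg: "degree Q = 3"
    and dist: "a \<noteq> b" "a \<noteq> c" "b \<noteq> c"
    and roots: "poly Q a = 0" "poly Q b = 0" "poly Q c = 0"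
  obtains k where "k \<noteq> 0" "Q = smult k ([:-a, 1:] * [:-b, 1:] * [:-c, 1:])"
proof -
  obtain q1 where q1: "Q = [:-a, 1:] * q1"
    using roots(1) by (auto simp: poly_eq_0_iff_dvd)
  have "poly q1 b = 0" using roots(2) dist by (simp add: q1)
  then obtain q2 where q2: "q1 = [:-b, 1:] * q2"
    by (auto simp: poly_eq_0_iff_dvd)
  have "poly q2 c = 0" using roots(3) dist by (simp add: q1 q2)
  then obtain q3 where q3: "q2 = [:-c, 1:] * q3"
    by (auto simp: poly_eq_0_iff_dvd)
  have Q: "Q = ([:-a, 1:] * [:-b, 1:] * [:-c, 1:]) * q3"
    by (simp only: q1 q2 q3 mult.assoc)
  have "q3 \<noteq> 0" using Q deg by auto
  then have "degree Q = 3 + degree q3"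
    unfolding Q by (subst degree_mult_eq) (auto simp: numeral_3_eq_3)
  then obtain k where "q3 = [:k:]"
    using deg by (metis add_cancel_right_right degree_eq_zeroE)
  with \<open>q3 \<noteq> 0\<close> Q show thesis
    by (intro that[of k]) (auto simp: mult.commute)
qed

text \<open>In the product rule at a root, only the term differentiating the vanishing factor
  survives; the summand \<open>1\<close> is the derivative of \<open>[:0, 1:]\<close>.\<close>

lemma multiplier_of_factorization:
  assumes "P - [:0, 1:] = smult k ([:-a, 1:] * [:-b, 1:] * [:-c, 1:])"
  shows "multiplier P a = 1 + k * (a - b) * (a - c)"
    and "multiplier P b = 1 + k * (b - a) * (b - c)"
    and "multiplier P c = 1 + k * (c - a) * (c - b)"
proof -
  have P: "P = [:0, 1:] + smult k ([:-a, 1:] * [:-b, 1:] * [:-c, 1:])"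
    using assms by (simp add: algebra_simps)
  show "multiplier P a = 1 + k * (a - b) * (a - c)"
    "multiplier P b = 1 + k * (b - a) * (b - c)"
    "multiplier P c = 1 + k * (c - a) * (c - b)"
    unfolding multiplier_def P
    by (simp_all add: pderiv_add pderiv_smult pderiv_mult pderiv_pCons algebra_simps)
qed

lemma Re_products_eq_0_iff_collinear:
  fixes a b c k :: complex
  assumes "k \<noteq> 0" and dist: "a \<noteq> b" "a \<noteq> c" "b \<noteq> c"
  defines "u \<equiv> k * (a - b) * (a - c)" and "v \<equiv> k * (b - a) * (b - c)"
    and "w \<equiv> k * (c - a) * (c - b)"
  shows "Re u = 0 \<and> Re v = 0 \<and> Re w = 0 \<longleftrightarrow>
    collinear {a, b, c} \<and> (Re u = 0 \<or> Re v = 0 \<or> Re w = 0)"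
proof -
  have collinear_iff: "collinear {a, b, c} \<longleftrightarrow> (\<exists>r::real. a - c = of_real r * (b - c))"
  proof -
    \<comment> \<open>\<open>collinear_3_expand\<close> expresses the middle listed point through
      the outer two, hence the reordering; \<open>dist\<close> excludes its degenerate case
      \<open>b = c\<close>.\<close>
    have "collinear {b, a, c} \<longleftrightarrow> (\<exists>r::real. a = r *\<^sub>R b + (1 - r) *\<^sub>R c)"
      using dist by (auto simp: collinear_3_expand)
    also have "\<dots> \<longleftrightarrow> (\<exists>r::real. a - c = of_real r * (b - c))"
      by (simp add: scaleR_conv_of_real algebra_simps)
    finally show ?thesis by (simp add: insert_commute)
  qed
  have imag_collinear: "collinear {a, b, c}" if "Re u = 0" "Re v = 0"
  proof -
    have "v \<noteq> 0" using assms by simp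
    have "u / v \<in> \<real>" using that by (simp add: complex_is_Real_iff Im_divide)
    then obtain s where s: "u / v = of_real s" by (auto elim: Reals_cases)
    have "u = - (a - c) / (b - c) * v"
      using dist by (simp add: u_def v_def field_simps)
    then have "of_real s = - (a - c) / (b - c)"
      using s \<open>v \<noteq> 0\<close> by simp
    then have "a - c = of_real (- s) * (b - c)"
      using dist by simp
    then show ?thesis using collinear_iff by blast
  qed
  have all_imag: "(Re u = 0 \<longleftrightarrow> Re v = 0) \<and> (Re u = 0 \<longleftrightarrow> Re w = 0)"
    if col: "collinear {a, b, c}"
  proof -
    obtain r :: real where "a - c = of_real r * (b - c)"
      using col collinear_iff by blast
    then have a: "a = c + of_real r * (b - c)" by (simp add: algebra_simps)
    \<comment> \<open>\<open>r = 0\<close> would give \<open>a = c\<close>, and \<open>r = 1\<close>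
      would give \<open>a = b\<close>. Hence the real coefficients of \<open>d\<close> below are all
      nonzero.\<close>
    have r: "r \<noteq> 0" "r \<noteq> 1" using a dist by auto
    define d where "d = k * (b - c)\<^sup>2"
    have "u = of_real (r * (r - 1)) * d" "v = of_real (1 - r) * d" "w = of_real r * d"
      unfolding u_def v_def w_def d_def a by (simp_all add: power2_eq_square algebra_simps)
    with r show ?thesis by simp
  qed
  show ?thesis using imag_collinear all_imag by blast
qed

theorem theorem3p2:
  fixes P :: "complex poly"
  assumes "degree P = 3"
    and "card (fixed_points P) = 3"
  shows "(\<forall>z\<in>fixed_points P. Re (multiplier P z) = 1) \<longleftrightarrow>
         collinear (fixed_points P) \<and> (\<exists>z\<in>fixed_points P. Re (multiplier P z) = 1)"
proof -
  obtain a b c where fp: "fixed_points P = {a, b, c}" and dist: "a \<noteq> b" "a \<noteq> c" "b \<noteq> c"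
    using assms(2) by (auto simp: card_3_iff)
  have deg: "degree (P - [:0, 1:]) = 3"
    using assms(1) degree_add_eq_left[of "- [:0, 1:]" P]
    by (simp add: diff_conv_add_uminus del: add_uminus_conv_diff)
  have root: "poly (P - [:0, 1:]) z = 0" if "z \<in> {a, b, c}" for z
    using that unfolding fp[symmetric] by (simp add: fixed_points_def)
  obtain k where "k \<noteq> 0" and k: "P - [:0, 1:] = smult k ([:-a, 1:] * [:-b, 1:] * [:-c, 1:])"
    using cubic_factor_roots[OF deg dist] root by blast
  \<comment> \<open>Each multiplier is \<open>1\<close> plus one of the three products, so it has
    real part \<open>1\<close> iff that product has real part \<open>0\<close>.\<close>
  show ?thesis
    using Re_products_eq_0_iff_collinear[OF \<open>k \<noteq> 0\<close> dist]
    by (simp add: fp multiplier_of_factorization[OF k])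
qed

end
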